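(* Let $\mathcal{G}$ be a connected finite undirected graph with vertex set $\mathcal{V}=\{1,\dots,n\}$ and neighbor sets $\mathbf{N}_i$. For each pair of adjacent vertices $i,j$ let $\alpha_{ij}=\alpha_{ji}>0$, $\beta_{ij}=-\beta_{ji}\in\mathbb{R}$ and $\gamma_{ij}=\gamma_{ji}\in\mathbb{R}$, and let $p_i^g,p_i^d\in\mathbb{R}$ satisfy $\sum_{i=1}^n p_i^g=\sum_{i=1}^n p_i^d$. Let ${\lambda^v}^\ast=({\lambda_1^v}^\ast,\dots,{\lambda_n^v}^\ast)$ be the limit as $t\to\infty$ of a solution of $$\dot\lambda_i^v=-\sum_{j\in\mathbf{N}_i}\frac{1}{4\alpha_{ij}}(\lambda_i^v-\lambda_j^v)-\sum_{j\in\mathbf{N}_i}\frac{\beta_{ij}}{2\alpha_{ij}}+(p_i^g-p_i^d),\qquad i=1,\dots,n,$$ and put $\lambda_{(i,j)}^{e\ast}=-\frac12({\lambda_i^v}^\ast+{\lambda_j^v}^\ast)$ for adjacent $i,j$. Then the energy flow $$p_{ij}=-\frac{1}{2\alpha_{ij}}\left(\beta_{ij}+{\lambda_i^v}^\ast+\lambda_{(i,j)}^{e\ast}\right)=-\frac{1}{2\alpha_{ij}}\left(\beta_{ij}+\tfrac12{\lambda_i^v}^\ast-\tfrac12{\lambda_j^v}^\ast\right)$$ (for all ordered pairs of adjacent vertices $(i,j)$) achieves the minimum in the optimization problem $$\min\ \sum_{(i,j)\in\mathcal{E}}\left(\alpha_{ij}p_{ij}^2+\beta_{ij}p_{ij}+\gamma_{ij}\right)$$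 subject to $p_i^d=p_i^g+\sum_{j\in\mathbf{N}_i}p_{ij}$ for all $i\in\mathcal{V}$ and $p_{ij}+p_{ji}=0$ for all adjacent $i,j$; that is, it is feasible and its cost is minimal among all feasible flows.
   Context: The flow variables are real numbers $p_{ij}$, one for each ordered pair $(i,j)$ of adjacent vertices ($p_{ij}$ is the energy flow from node $j$ to node $i$). In the cost, $\mathcal{E}$ is the set of all ordered pairs of adjacent vertices, i.e. $\mathcal{E}=\mathcal{E}^+\cup\mathcal{E}^-$, where $\mathcal{E}^+$ contains each edge with one arbitrarily assigned direction and $\mathcal{E}^-$ contains the opposite directions; so the cost is $\sum_{i=1}^n\sum_{j\in\mathbf{N}_i}(\alpha_{ij}p_{ij}^2+\beta_{ij}p_{ij}+\gamma_{ij})$. Here $p_i^g$ is the (given) generated energy and $p_i^d$ the desired energy at node $i$. *)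

theory Defs
  imports Complex_Main "Graph_Theory.Graph_Theory"
begin

text \<open>
  A \<open>pair_graph\<close> is a finite, loop-free digraph with symmetric set of arcs \<open>parcs G\<close>, i.e. a finite
  simple undirected graph; \<open>parcs G\<close> is then the set of all ordered pairs of adjacent vertices.
\<close>

definition nbrs :: "nat pair_pre_digraph \<Rightarrow> nat \<Rightarrow> nat set" where
  "nbrs G i = {j. (i, j) \<in> parcs G}"

definition is_dual_flow_solution ::
  "nat pair_pre_digraph \<Rightarrow> (nat \<Rightarrow> nat \<Rightarrow> real) \<Rightarrow> (nat \<Rightarrow> nat \<Rightarrow> real) \<Rightarrow>
    (nat \<Rightarrow> real) \<Rightarrow> (nat \<Rightarrow> real) \<Rightarrow> (real \<Rightarrow> nat \<Rightarrow> real) \<Rightarrow> bool" where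
  "is_dual_flow_solution G \<alpha> \<beta> pg pd \<Lambda> \<longleftrightarrow>
    (\<forall>t\<ge>0. \<forall>i\<in>pverts G.
      ((\<lambda>s. \<Lambda> s i) has_real_derivative
        (- (\<Sum>j\<in>nbrs G i. 1 / (4 * \<alpha> i j) * (\<Lambda> t i - \<Lambda> t j))
         - (\<Sum>j\<in>nbrs G i. \<beta> i j / (2 * \<alpha> i j))
         + (pg i - pd i))) (at t within {0..}))"

text \<open>
  A flow is represented by a total function \<open>p\<close>, with \<open>p i j\<close> the energy flow from \<open>j\<close> to \<open>i\<close>;
  only its values on \<open>parcs G\<close> are constrained and enter the cost.
\<close>

definition feasible_flow ::
  "nat pair_pre_digraph \<Rightarrow> (nat \<Rightarrow> real) \<Rightarrow> (nat \<Rightarrow> real) \<Rightarrow> (nat \<Rightarrow> nat \<Rightarrow> real) \<Rightarrow> bool" where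
  "feasible_flow G pg pd p \<longleftrightarrow>
    (\<forall>i\<in>pverts G. pd i = pg i + (\<Sum>j\<in>nbrs G i. p i j)) \<and>
    (\<forall>(i, j)\<in>parcs G. p i j + p j i = 0)"

definition flow_cost ::
  "nat pair_pre_digraph \<Rightarrow> (nat \<Rightarrow> nat \<Rightarrow> real) \<Rightarrow> (nat \<Rightarrow> nat \<Rightarrow> real) \<Rightarrow> (nat \<Rightarrow> nat \<Rightarrow> real) \<Rightarrow>
    (nat \<Rightarrow> nat \<Rightarrow> real) \<Rightarrow> real" where
  "flow_cost G \<alpha> \<beta> \<gamma> p = (\<Sum>(i, j)\<in>parcs G. \<alpha> i j * (p i j)\<^sup>2 + \<beta> i j * p i j + \<gamma> i j)"

end

theory Submission
  imports Defs
begin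

text \<open>
  If a function and its derivative both converge at infinity, the derivative tends to \<open>0\<close>; hence the
  limit potentials are an equilibrium of the dual flow, and equilibrium at \<open>i\<close> is exactly the balance
  equation of \<open>p\<close> at \<open>i\<close>. Optimality follows since the marginal cost \<open>2 \<alpha> p + \<beta>\<close> on an arc is a
  potential difference, and potential differences are orthogonal to antisymmetric flows with zero
  net inflow at each vertex.
\<close>

text \<open>By the mean value theorem on \<open>[t, t + 1]\<close>, the increment
  \<open>f (t + 1) - f t\<close> is a value \<open>f' (z t)\<close> with \<open>z t > t\<close>. As
  \<open>t\<close> grows, the increments tend to \<open>L - L\<close>, while the values
  \<open>f' (z t)\<close> tend to \<open>c\<close>.\<close>

lemma derivative_limit_eq_0:
  fixes f f' :: "real \<Rightarrow> real"
  assumes deriv: "\<And>t. t \<ge> a \<Longrightarrow> (f has_real_derivative f' t) (at t within {a..})"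
    and f: "(f \<longlongrightarrow> L) at_top"
    and f': "(f' \<longlongrightarrow> c) at_top"
  shows "c = 0"
proof -
  have "\<exists>z. t < z \<and> f (t + 1) - f t = f' z" if "t > a" for t
  proof -
    \<comment> \<open>The one-sided derivative at \<open>a\<close> is avoided: \<open>t > a\<close>
      puts \<open>x\<close> in the open set \<open>{a<..}\<close>, where the derivative within
      \<open>{a..}\<close> is a full derivative.\<close>
    have "DERIV f x :> f' x" if "t \<le> x" for x
      using DERIV_subset[OF deriv, of x "{a<..}"] that \<open>t > a\<close>
      by (simp add: at_within_open[where S = "{a<..}"] subset_eq)
    from MVT2[of t "t + 1", OF _ this] show ?thesis by auto
  qed
  then obtain z where z: "\<And>t. t > a \<Longrightarrow> t < z t \<and> f (t + 1) - f t = f' (z t)"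
    by metis
  have "filterlim z at_top at_top"
    using filterlim_ident
    by (rule filterlim_at_top_mono)
       (use z in \<open>auto intro!: eventually_mono[OF eventually_gt_at_top[of a]] less_imp_le\<close>)
  then have "((\<lambda>t. f' (z t)) \<longlongrightarrow> c) at_top"
    by (rule filterlim_compose[OF f'])
  moreover have "filterlim (\<lambda>t. t + 1 :: real) at_top at_top"
    using filterlim_ident
    by (rule filterlim_at_top_mono) (auto intro!: always_eventually)
  then have "((\<lambda>t. f (t + 1) - f t) \<longlongrightarrow> L - L) at_top"
    by (intro tendsto_diff f filterlim_compose[OF f])
  then have "((\<lambda>t. f' (z t)) \<longlongrightarrow> L - L) at_top"
    by (rule Lim_transform_eventually)
       (use z in \<open>auto intro!: eventually_mono[OF eventually_gt_at_top[of a]]\<close>)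
  ultimately show ?thesis
    using tendsto_unique[OF trivial_limit_at_top_linorder] by force
qed

text \<open>The right-hand side of the flow depends continuously on the potentials, so the
  derivative converges to its value at \<open>lv\<close>, and \<open>derivative_limit_eq_0\<close>
  makes this value vanish.\<close>

lemma dual_flow_limit_equilibrium:
  assumes "pair_graph G"
    and sol: "is_dual_flow_solution G \<alpha> \<beta> pg pd \<Lambda>"
    and limit: "\<And>i. i \<in> pverts G \<Longrightarrow> ((\<lambda>t. \<Lambda> t i) \<longlongrightarrow> lv i) at_top"
    and i: "i \<in> pverts G"
  shows "- (\<Sum>j\<in>nbrs G i. 1 / (4 * \<alpha> i j) * (lv i - lv j))
         - (\<Sum>j\<in>nbrs G i. \<beta> i j / (2 * \<alpha> i j)) + (pg i - pd i) = 0"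
proof (rule derivative_limit_eq_0[where a = 0 and f = "\<lambda>t. \<Lambda> t i"])
  interpret pair_graph G by fact
  show "((\<lambda>s. \<Lambda> s i) has_real_derivative
        (- (\<Sum>j\<in>nbrs G i. 1 / (4 * \<alpha> i j) * (\<Lambda> t i - \<Lambda> t j))
         - (\<Sum>j\<in>nbrs G i. \<beta> i j / (2 * \<alpha> i j))
         + (pg i - pd i))) (at t within {0..})" if "t \<ge> 0" for t
    using sol i that by (simp add: is_dual_flow_solution_def)
  \<comment> \<open>Convergence is assumed at vertices only, so neighbours must be known to be
    vertices.\<close>
  have "j \<in> pverts G" if "j \<in> nbrs G i" for j
    using that by (auto simp: nbrs_def dest: in_arcsD2)
  then show "((\<lambda>t. - (\<Sum>j\<in>nbrs G i. 1 / (4 * \<alpha> i j) * (\<Lambda> t i - \<Lambda> t j))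
         - (\<Sum>j\<in>nbrs G i. \<beta> i j / (2 * \<alpha> i j)) + (pg i - pd i)) \<longlongrightarrow>
        - (\<Sum>j\<in>nbrs G i. 1 / (4 * \<alpha> i j) * (lv i - lv j))
         - (\<Sum>j\<in>nbrs G i. \<beta> i j / (2 * \<alpha> i j)) + (pg i - pd i)) at_top"
    by (intro tendsto_intros limit i)
qed (rule limit[OF i])

lemma sum_parcs_eq_sum_nbrs:
  assumes "pair_graph G"
  shows "(\<Sum>(i, j)\<in>parcs G. h i j) = (\<Sum>i\<in>pverts G. \<Sum>j\<in>nbrs G i. h i j)"
proof -
  interpret pair_graph G by fact
  have "parcs G = Sigma (pverts G) (nbrs G)"
    by (auto simp: nbrs_def dest: in_arcsD1)
  moreover have "finite (nbrs G i)" for i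
    by (rule finite_subset[OF _ finite_imageI[OF pair_finite_arcs, of snd]])
       (force simp: nbrs_def)
  ultimately show ?thesis
    by (simp add: sum.Sigma)
qed

lemma sum_parcs_swap:
  assumes "pair_graph G"
  shows "(\<Sum>(i, j)\<in>parcs G. h i j) = (\<Sum>(i, j)\<in>parcs G. h j i)"
proof -
  interpret pair_graph G by fact
  show ?thesis
    by (rule sum.reindex_bij_witness[where i = prod.swap and j = prod.swap])
       (auto intro: arcs_symmetric)
qed

text \<open>Summation by parts: grouped by first endpoint, the \<open>l i\<close> part vanishes at
  each vertex by \<open>div\<close>. Reversing all arcs and using \<open>anti\<close> turns the
  \<open>l j\<close> part into the negative of the \<open>l i\<close> part.\<close>

lemma potential_difference_orthogonal:
  fixes d :: "nat \<Rightarrow> nat \<Rightarrow> real"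
  assumes G: "pair_graph G"
    and div: "\<And>i. i \<in> pverts G \<Longrightarrow> (\<Sum>j\<in>nbrs G i. d i j) = 0"
    and anti: "\<And>i j. (i, j) \<in> parcs G \<Longrightarrow> d j i = - d i j"
  shows "(\<Sum>(i, j)\<in>parcs G. (l i - l j) * d i j) = 0"
proof -
  have 0: "(\<Sum>(i, j)\<in>parcs G. l i * d i j) = 0"
    by (simp add: sum_parcs_eq_sum_nbrs[OF G] div flip: sum_distrib_left)
  have "(\<Sum>(i, j)\<in>parcs G. l j * d i j) = - (\<Sum>(i, j)\<in>parcs G. l j * d j i)"
    by (simp add: sum_negf[symmetric] case_prod_unfold anti)
  also have "\<dots> = 0"
    using 0 sum_parcs_swap[OF G, of "\<lambda>i j. l i * d i j"] by simp
  finally show ?thesis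
    using 0 by (simp add: left_diff_distrib case_prod_unfold sum_subtractf)
qed

theorem mainTheorem3:
  fixes G :: "nat pair_pre_digraph" and n :: nat
    and \<alpha> \<beta> \<gamma> :: "nat \<Rightarrow> nat \<Rightarrow> real"
    and pg pd :: "nat \<Rightarrow> real"
    and \<Lambda> :: "real \<Rightarrow> nat \<Rightarrow> real"
    and lv :: "nat \<Rightarrow> real"
    and le p :: "nat \<Rightarrow> nat \<Rightarrow> real"
  assumes graph: "pair_graph G"
    and verts: "pverts G = {1..n}"
    and conn: "Digraph_Component.connected (with_proj G)"
    and alpha: "\<And>i j. (i, j) \<in> parcs G \<Longrightarrow> \<alpha> i j = \<alpha> j i \<and> \<alpha> i j > 0"
    and beta: "\<And>i j. (i, j) \<in> parcs G \<Longrightarrow> \<beta> i j = - \<beta> j i"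
    and gamma: "\<And>i j. (i, j) \<in> parcs G \<Longrightarrow> \<gamma> i j = \<gamma> j i"
    and balance: "(\<Sum>i=1..n. pg i) = (\<Sum>i=1..n. pd i)"
    and solution: "is_dual_flow_solution G \<alpha> \<beta> pg pd \<Lambda>"
    and limit: "\<And>i. i \<in> {1..n} \<Longrightarrow> ((\<lambda>t. \<Lambda> t i) \<longlongrightarrow> lv i) at_top"
    and le: "\<And>i j. (i, j) \<in> parcs G \<Longrightarrow> le i j = - (1 / 2) * (lv i + lv j)"
    and p: "\<And>i j. (i, j) \<in> parcs G \<Longrightarrow> p i j = - (1 / (2 * \<alpha> i j)) * (\<beta> i j + lv i + le i j)"
  shows "(\<forall>(i, j)\<in>parcs G.
            p i j = - (1 / (2 * \<alpha> i j)) * (\<beta> i j + 1 / 2 * lv i - 1 / 2 * lv j))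
       \<and> is_arg_min (flow_cost G \<alpha> \<beta> \<gamma>) (feasible_flow G pg pd) p"
proof
  show form: "\<forall>(i, j)\<in>parcs G.
      p i j = - (1 / (2 * \<alpha> i j)) * (\<beta> i j + 1 / 2 * lv i - 1 / 2 * lv j)"
  proof safe
    fix i j assume ij: "(i, j) \<in> parcs G"
    have "\<beta> i j + lv i + le i j = \<beta> i j + 1 / 2 * lv i - 1 / 2 * lv j"
      by (simp add: le[OF ij] field_simps)
    with p[OF ij] show "p i j = - (1 / (2 * \<alpha> i j)) * (\<beta> i j + 1 / 2 * lv i - 1 / 2 * lv j)"
      by simp
  qed
  interpret pair_graph G by (rule graph)
  \<comment> \<open>Stationarity of the Lagrangian in \<open>p i j\<close>, obtained by clearing the
    positive denominator \<open>2 * \<alpha> i j\<close>.\<close>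
  have marginal: "2 * \<alpha> i j * p i j + \<beta> i j = (- 1 / 2) * (lv i - lv j)" if "(i, j) \<in> parcs G" for i j
    using bspec[OF form that] alpha[OF that] by (simp add: field_simps)
  have feasible: "feasible_flow G pg pd p"
    unfolding feasible_flow_def
  proof (intro conjI ballI; safe?)
    fix i assume i: "i \<in> pverts G"
    \<comment> \<open>The factor \<open>1 / 2\<close> of the potentials turns
      \<open>1 / (2 * \<alpha> i j)\<close> into the coefficient
      \<open>1 / (4 * \<alpha> i j)\<close> of the dual flow.\<close>
    have "(\<Sum>j\<in>nbrs G i. p i j)
        = (\<Sum>j\<in>nbrs G i. - (1 / (4 * \<alpha> i j) * (lv i - lv j)) - \<beta> i j / (2 * \<alpha> i j))"
    proof (rule sum.cong)
      fix j assume "j \<in> nbrs G i"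
      then have ij: "(i, j) \<in> parcs G" by (simp add: nbrs_def)
      show "p i j = - (1 / (4 * \<alpha> i j) * (lv i - lv j)) - \<beta> i j / (2 * \<alpha> i j)"
        using bspec[OF form ij] alpha[OF ij] by (simp add: diff_divide_distrib add_divide_distrib)
    qed simp
    also have "\<dots> = pd i - pg i"
      using dual_flow_limit_equilibrium[OF graph solution limit[folded verts] i]
      by (simp add: sum_subtractf sum_negf)
    finally show "pd i = pg i + (\<Sum>j\<in>nbrs G i. p i j)" by simp
  next
    fix i j assume ij: "(i, j) \<in> parcs G"
    then have ji: "(j, i) \<in> parcs G" by (rule arcs_symmetric)
    \<comment> \<open>Adding the marginal costs of both directions cancels the potential differences
      and, by antisymmetry, the \<beta> terms; symmetry of \<alpha> gives the common factor.\<close>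
    have "2 * \<alpha> i j * (p i j + p j i) = 0"
      using marginal[OF ij] marginal[OF ji] alpha[OF ij] beta[OF ij]
      by (simp add: field_simps)
    then show "p i j + p j i = 0" using alpha[OF ij] by simp
  qed
  have optimal: "flow_cost G \<alpha> \<beta> \<gamma> p \<le> flow_cost G \<alpha> \<beta> \<gamma> q"
    if q: "feasible_flow G pg pd q" for q
  proof -
    \<comment> \<open>As a difference of two feasible flows, \<open>d\<close> satisfies the
      homogeneous constraints: it is an antisymmetric circulation.\<close>
    define d where "d i j = q i j - p i j" for i j
    have div: "(\<Sum>j\<in>nbrs G i. d i j) = 0" if "i \<in> pverts G" for i
    proof -
      have "pd i = pg i + (\<Sum>j\<in>nbrs G i. p i j)" "pd i = pg i + (\<Sum>j\<in>nbrs G i. q i j)"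
        using feasible q that unfolding feasible_flow_def by blast+
      then show ?thesis by (simp add: d_def sum_subtractf)
    qed
    have anti: "d j i = - d i j" if "(i, j) \<in> parcs G" for i j
    proof -
      have "p i j + p j i = 0" "q i j + q j i = 0"
        using feasible q that unfolding feasible_flow_def by blast+
      then show ?thesis by (simp add: d_def)
    qed
    \<comment> \<open>The cost is quadratic, so its second-order expansion around \<open>p\<close>
      is exact; the \<gamma> terms cancel.\<close>
    have "flow_cost G \<alpha> \<beta> \<gamma> q - flow_cost G \<alpha> \<beta> \<gamma> p
        = (\<Sum>(i, j)\<in>parcs G. \<alpha> i j * (d i j)\<^sup>2 + (2 * \<alpha> i j * p i j + \<beta> i j) * d i j)"
      unfolding flow_cost_def sum_subtractf[symmetric] d_def
      by (rule sum.cong) (auto simp: algebra_simps power2_eq_square)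
    also have "\<dots> = (\<Sum>(i, j)\<in>parcs G. \<alpha> i j * (d i j)\<^sup>2 + (- 1 / 2) * ((lv i - lv j) * d i j))"
    proof (rule sum.cong; safe)
      fix i j assume "(i, j) \<in> parcs G"
      from marginal[OF this]
      show "\<alpha> i j * (d i j)\<^sup>2 + (2 * \<alpha> i j * p i j + \<beta> i j) * d i j
          = \<alpha> i j * (d i j)\<^sup>2 + (- 1 / 2) * ((lv i - lv j) * d i j)"
        by (simp only: mult.assoc[of "- 1 / 2"])
    qed
    also have "\<dots> = (\<Sum>(i, j)\<in>parcs G. \<alpha> i j * (d i j)\<^sup>2)
        + (- 1 / 2) * (\<Sum>(i, j)\<in>parcs G. (lv i - lv j) * d i j)"
      by (simp only: case_prod_unfold sum.distrib sum_distrib_left)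
    \<comment> \<open>The first-order term pairs a potential difference with the circulation
      \<open>d\<close>, hence vanishes.\<close>
    also have "\<dots> = (\<Sum>(i, j)\<in>parcs G. \<alpha> i j * (d i j)\<^sup>2)"
      by (simp only: potential_difference_orthogonal[OF graph div anti])
    also have "\<dots> \<ge> 0"
      using alpha by (force intro!: sum_nonneg mult_nonneg_nonneg intro: less_imp_le)
    finally show ?thesis by simp
  qed
  show "is_arg_min (flow_cost G \<alpha> \<beta> \<gamma>) (feasible_flow G pg pd) p"
    using feasible optimal by (auto simp: is_arg_min_linorder)
qed

end
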